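(* Let $G$ be a cyclic group of prime order $p$ (written additively) and let $S$ be a minimal zero-sum sequence over $G$ of length $5$. If $\mathsf h(S)\ge 3$, then $\operatorname{ind}(S)=1$.
   Context: Let $G$ be a finite cyclic group written additively. A sequence over $G$ is an element of the free abelian monoid $\mathcal F(G)$ with basis $G$, i.e. a finite multiset of elements of $G$ written multiplicatively; its length is the number of terms counted with multiplicity. $S$ is a zero-sum sequence if the sum of its terms is $0$; it is a minimal zero-sum sequence if in addition no proper nontrivial (nonempty) subsequence has sum $0$. $\mathsf h(S)$ denotes the maximal multiplicity of an element in $S$. Index: for each generator $g$ of $G$ one can write $S=(n_1g)\cdot\ldots\cdot(n_lg)$ with unique $n_1,\ldots,n_l\in[1,\operatorname{ord}(g)]$, and one sets $\|S\|_g=\frac{n_1+\cdots+n_l}{\operatorname{ord}(g)}$; then $\operatorname{ind}(S)=\min\{\|S\|_g : g\in G,\ G=\langle g\rangle\}$. *)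

theory Defs
  imports "HOL-Computational_Algebra.Primes" "HOL-Library.Multiset" "HOL-Algebra.Elementary_Groups" "HOL-Algebra.Multiplicative_Group"
begin

text \<open>
  Groups are those of HOL-Algebra, whose operation is written multiplicatively: the sum of two
  elements is \<open>\<otimes>\<close>, zero is \<open>\<one>\<close>, and the multiple \<open>n g\<close> is \<open>g [^] n\<close>.  A sequence over
  \<open>G\<close> (an element of the free abelian monoid with basis \<open>G\<close>) is a finite multiset of elements of
  the carrier; its subsequences are its submultisets and its length is its size.
\<close>

definition seq_over :: "('a, 'b) monoid_scheme \<Rightarrow> 'a multiset \<Rightarrow> bool" where
  "seq_over G S \<longleftrightarrow> set_mset S \<subseteq> carrier G"

text \<open>
  The sum of the terms of \<open>S\<close>, collecting equal terms (HOL-Algebra has products over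
  finite sets, not over multisets).
\<close>

definition seq_sum :: "('a, 'b) monoid_scheme \<Rightarrow> 'a multiset \<Rightarrow> 'a" where
  "seq_sum G S = finprod G (\<lambda>x. x [^]\<^bsub>G\<^esub> count S x) (set_mset S)"

definition zero_sum :: "('a, 'b) monoid_scheme \<Rightarrow> 'a multiset \<Rightarrow> bool" where
  "zero_sum G S \<longleftrightarrow> seq_over G S \<and> seq_sum G S = \<one>\<^bsub>G\<^esub>"

definition minimal_zero_sum :: "('a, 'b) monoid_scheme \<Rightarrow> 'a multiset \<Rightarrow> bool" where
  "minimal_zero_sum G S \<longleftrightarrow>
     zero_sum G S \<and> (\<forall>T. T \<subset># S \<and> T \<noteq> {#} \<longrightarrow> \<not> zero_sum G T)"

text \<open>
  The maximum runs over all of \<open>G\<close> and not just over the terms of \<open>S\<close>, so that the empty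
  sequence gets the value \<open>0\<close>.  This and \<open>ind\<close> below are meant for finite \<open>G\<close>.
\<close>

definition max_mult :: "('a, 'b) monoid_scheme \<Rightarrow> 'a multiset \<Rightarrow> nat" where
  "max_mult G S = Max ((\<lambda>g. count S g) ` carrier G)"

definition generators :: "('a, 'b) monoid_scheme \<Rightarrow> 'a set" where
  "generators G = {g \<in> carrier G. generate G {g} = carrier G}"

definition coefficient :: "('a, 'b) monoid_scheme \<Rightarrow> 'a \<Rightarrow> 'a \<Rightarrow> nat" where
  "coefficient G g x = (THE n. n \<in> {1..group.ord G g} \<and> x = g [^]\<^bsub>G\<^esub> n)"

definition seq_norm :: "('a, 'b) monoid_scheme \<Rightarrow> 'a \<Rightarrow> 'a multiset \<Rightarrow> rat" where
  "seq_norm G g S = of_nat (\<Sum>x\<in>#S. coefficient G g x) / of_nat (group.ord G g)"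

definition ind :: "('a, 'b) monoid_scheme \<Rightarrow> 'a multiset \<Rightarrow> rat" where
  "ind G S = Min ((\<lambda>g. seq_norm G g S) ` generators G)"

lemma (in comm_group) seq_sum_empty: "seq_sum G {#} = \<one>"
  by (simp add: seq_sum_def)

lemma (in comm_group) seq_sum_add_mset:
  assumes "x \<in> carrier G" "seq_over G S"
  shows "seq_sum G (add_mset x S) = x \<otimes> seq_sum G S"
proof -
  let ?A = "insert x (set_mset S)" and ?B = "set_mset S - {x}"
  have *: "finprod G (\<lambda>y. y [^] count M y) ?A =
      x [^] count M x \<otimes> finprod G (\<lambda>y. y [^] count M y) ?B" for M
  proof -
    have "?A = insert x ?B" by auto
    moreover have "finprod G (\<lambda>y. y [^] count M y) (insert x ?B) =
        x [^] count M x \<otimes> finprod G (\<lambda>y. y [^] count M y) ?B"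
      using assms by (intro finprod_insert) (auto simp: seq_over_def)
    ultimately show ?thesis by simp
  qed
  have "seq_sum G S = finprod G (\<lambda>y. y [^] count S y) ?A"
    unfolding seq_sum_def
    using assms by (intro finprod_mono_neutral_cong_left)
      (auto simp: seq_over_def not_in_iff)
  moreover have "finprod G (\<lambda>y. y [^] count (add_mset x S) y) ?B = finprod G (\<lambda>y. y [^] count S y) ?B"
    using assms by (intro finprod_cong') (auto simp: seq_over_def)
  moreover have "finprod G (\<lambda>y. y [^] count S y) ?B \<in> carrier G"
    using assms by (intro finprod_closed) (auto simp: seq_over_def)
  ultimately show ?thesis
    using assms *[of S] *[of "add_mset x S"]
    by (simp add: seq_sum_def m_ac)
qed

lemma (in group) ex1_coefficient:
  assumes "finite (carrier G)" "g \<in> generators G" "x \<in> carrier G"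
  shows "\<exists>!n. n \<in> {1..ord g} \<and> x = g [^] n"
proof -
  have g: "g \<in> carrier G" and gen: "generate G {g} = carrier G"
    using assms by (auto simp: generators_def)
  have pos: "ord g > 0"
    using ord_ge_1[OF assms(1) g] by simp
  obtain m :: nat where m: "x = g [^] m"
    using generate_pow_nat[OF g] gen pos assms(3) by auto
  define n where "n = (if m mod ord g = 0 then ord g else m mod ord g)"
  have "g [^] m = g [^] (m mod ord g)"
  proof -
    have "g [^] m = g [^] (ord g * (m div ord g)) \<otimes> g [^] (m mod ord g)"
      using g by (simp add: nat_pow_mult)
    also have "g [^] (ord g * (m div ord g)) = \<one>"
      using g by (simp add: pow_eq_id)
    finally show ?thesis
      using g by simp
  qed
  then have "x = g [^] n"
    using m g by (simp add: n_def)
  moreover have "n \<in> {1..ord g}"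
    using pos mod_less_divisor[OF pos, of m] by (auto simp: n_def)
  ultimately show ?thesis
    using ord_inj'[OF g] by (metis inj_onD)
qed

end

theory Submission
  imports Defs
begin

text \<open>
  A term \<open>g\<close> of multiplicity at least three is not the neutral element, so in a group of prime
  order it is a generator, and \<open>S\<close> consists of three copies of \<open>g\<close> and two further terms
  \<open>x\<close> and \<open>y\<close>.  The minimum defining the index is attained at \<open>g\<close> itself: the three
  copies have coefficient \<open>1\<close>, and minimality of \<open>S\<close> forces the coefficients of
  \<open>g, g, g, x\<close> to add up to less than \<open>p\<close>.  As the coefficient of \<open>y\<close> is at most \<open>p\<close>,
  all five add up to a positive multiple of \<open>p\<close> below \<open>2 p\<close>, that is, to \<open>p\<close>
  (lemma \<open>seq_norm_eq_1\<close>).  No generator gives less, because the norm of a nonempty zero-sum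
  sequence is a positive integer (lemma \<open>seq_norm_ge_1\<close>).
\<close>

lemma (in group) coefficient_in_range:
  assumes "finite (carrier G)" "g \<in> generators G" "x \<in> carrier G"
  shows "coefficient G g x \<in> {1..ord g}" and "g [^] coefficient G g x = x"
  using theI'[OF ex1_coefficient[OF assms]] unfolding coefficient_def by auto

lemma (in group) coefficient_self:
  assumes "finite (carrier G)" "g \<in> generators G"
  shows "coefficient G g g = 1"
proof -
  have g: "g \<in> carrier G"
    using assms(2) by (simp add: generators_def)
  have "1 \<in> {1..ord g} \<and> g = g [^] (1::nat)"
    using g ord_ge_1[OF assms(1) g] by simp
  then show ?thesis
    unfolding coefficient_def using the1_equality[OF ex1_coefficient[OF assms g]] by blast
qed

lemma (in comm_group) seq_sum_eq_generator_pow: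
  assumes "finite (carrier G)" "g \<in> generators G" "seq_over G S"
  shows "seq_sum G S = g [^] (\<Sum>x\<in>#S. coefficient G g x)"
  using assms(3)
proof (induction S)
  case empty
  then show ?case by (simp add: seq_sum_empty)
next
  case (add x S)
  then have x: "x \<in> carrier G" and S: "seq_over G S"
    by (auto simp: seq_over_def)
  have g: "g \<in> carrier G"
    using assms(2) by (simp add: generators_def)
  have "seq_sum G (add_mset x S) = g [^] coefficient G g x \<otimes> g [^] (\<Sum>x\<in>#S. coefficient G g x)"
    using seq_sum_add_mset[OF x S] add.IH[OF S] coefficient_in_range(2)[OF assms(1,2) x] by simp
  then show ?case
    using g by (simp add: nat_pow_mult)
qed

text \<open>
  Coefficients turn the group-theoretic condition into a divisibility, after which everything
  about zero-sum sequences is arithmetic of natural numbers.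
\<close>

lemma (in comm_group) zero_sum_iff_dvd:
  assumes "finite (carrier G)" "g \<in> generators G" "seq_over G S"
  shows "zero_sum G S \<longleftrightarrow> ord g dvd (\<Sum>x\<in>#S. coefficient G g x)"
proof -
  have "g \<in> carrier G"
    using assms(2) by (simp add: generators_def)
  then show ?thesis
    using assms by (simp add: zero_sum_def seq_sum_eq_generator_pow pow_eq_id)
qed

text \<open>
  Coefficients are taken from \<open>1\<close> on, so those of a nonempty zero-sum sequence add up to
  a \<^emph>\<open>positive\<close> multiple of the order.
\<close>

lemma (in comm_group) seq_norm_ge_1:
  assumes fin: "finite (carrier G)" and gen: "g \<in> generators G"
    and S: "zero_sum G S" "S \<noteq> {#}"
  shows "seq_norm G g S \<ge> 1"
proof -
  let ?s = "\<Sum>x\<in>#S. coefficient G g x"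
  have g: "g \<in> carrier G"
    using gen by (simp add: generators_def)
  have over: "seq_over G S"
    using S(1) by (simp add: zero_sum_def)
  obtain x S' where S': "S = add_mset x S'"
    using S(2) by (metis multiset_cases)
  then have "x \<in> carrier G"
    using over by (auto simp: seq_over_def)
  then have "?s > 0"
    using coefficient_in_range(1)[OF fin gen] S' by fastforce
  moreover have "ord g dvd ?s"
    using zero_sum_iff_dvd[OF fin gen over] S(1) by simp
  ultimately have "ord g \<le> ?s"
    by (rule dvd_imp_le[rotated])
  moreover have "ord g > 0"
    using ord_ge_1[OF fin g] by simp
  ultimately show ?thesis
    by (simp add: seq_norm_def del: of_nat_sum_mset)
qed

text \<open>
  Add the copies of \<open>g\<close> to the subsequence \<open>x\<close> one at a time: the sum of coefficients
  starts at or below \<open>ord g\<close> and grows by \<open>1\<close> at each step, so it cannot pass \<open>ord g\<close>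
  without hitting it, and hitting it would give a zero-sum subsequence that misses \<open>y\<close>.
  Hence \<open>k\<close> copies of \<open>g\<close> together with \<open>x\<close> still sum to less than \<open>ord g\<close>, and
  the one remaining term \<open>y\<close> cannot bring the total up to \<open>2 ord g\<close>.
\<close>

lemma (in comm_group) seq_norm_eq_1:
  assumes fin: "finite (carrier G)" and gen: "g \<in> generators G"
    and min: "minimal_zero_sum G S" and S: "S = replicate_mset k g + {#x, y#}"
  shows "seq_norm G g S = 1"
proof -
  define a b where "a = coefficient G g x" and "b = coefficient G g y"
  have g: "g \<in> carrier G"
    using gen by (simp add: generators_def)
  have pos: "ord g > 0"
    using ord_ge_1[OF fin g] by simp
  have zero: "zero_sum G S" and over: "seq_over G S"
    using min by (auto simp: minimal_zero_sum_def zero_sum_def)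
  then have "x \<in> carrier G" "y \<in> carrier G"
    by (auto simp: seq_over_def S)
  then have ab: "a \<in> {1..ord g}" "b \<in> {1..ord g}"
    using coefficient_in_range(1)[OF fin gen] by (auto simp: a_def b_def)
  have no_hit: "j + a \<noteq> ord g" if "j \<le> k" for j
  proof
    assume hit: "j + a = ord g"
    let ?T = "replicate_mset j g + {#x#}"
    have "replicate_mset k g = replicate_mset j g + replicate_mset (k - j) g"
      using that by (intro multiset_eqI) simp
    then have S_eq: "S = ?T + add_mset y (replicate_mset (k - j) g)"
      by (simp add: S)
    have "?T \<subseteq># S"
      unfolding S_eq by (rule mset_subset_eq_add_left)
    moreover have "size ?T < size S"
      unfolding S_eq by simp
    ultimately have sub: "?T \<subset># S"
      by (metis less_irrefl subset_mset.le_neq_trans)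
    have "seq_over G ?T"
      using over S_eq by (simp add: seq_over_def)
    moreover have "(\<Sum>z\<in>#?T. coefficient G g z) = ord g"
      using hit coefficient_self[OF fin gen] by (simp add: a_def image_replicate_mset)
    ultimately have "zero_sum G ?T"
      using zero_sum_iff_dvd[OF fin gen] by simp
    then show False
      using min sub by (auto simp: minimal_zero_sum_def)
  qed
  have "j + a < ord g" if "j \<le> k" for j
    using that
  proof (induction j)
    case 0
    then show ?case using ab no_hit[of 0] by simp
  next
    case (Suc j)
    then show ?case using no_hit[of "Suc j"] by simp
  qed
  then have upper: "k + a + b < 2 * ord g"
    using ab(2) by (metis add_less_le_mono atLeastAtMost_iff le_refl mult_2)
  have total: "(\<Sum>z\<in>#S. coefficient G g z) = k + a + b"
    using coefficient_self[OF fin gen] by (simp add: S a_def b_def image_replicate_mset)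
  have "ord g dvd k + a + b"
    using zero_sum_iff_dvd[OF fin gen over] zero total by simp
  then obtain m where m: "k + a + b = ord g * m" ..
  have "m > 0"
    using m ab by (cases m) auto
  moreover have "m < 2"
    using m upper pos by (metis mult.commute nat_mult_less_cancel1)
  ultimately have "m = 1" by simp
  then have "k + a + b = ord g"
    using m by simp
  then show ?thesis
    using total pos by (simp add: seq_norm_def)
qed

lemma (in group) generator_if_prime_order:
  assumes "prime (order G)" "g \<in> carrier G" "g \<noteq> \<one>"
  shows "g \<in> generators G"
proof -
  have fin: "finite (carrier G)"
    using prime_gt_0_nat[OF assms(1)] order_gt_0_iff_finite by simp
  have "ord g \<noteq> 1"
    using assms(2,3) ord_eq_1 by blast
  then have "ord g = order G"
    using assms(1) ord_dvd_group_order[OF assms(2)] unfolding prime_nat_iff by blast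
  then have "card (generate G {g}) = card (carrier G)"
    using generate_pow_card[OF assms(2)] by (simp add: order_def)
  moreover have "generate G {g} \<subseteq> carrier G"
    using generate_incl assms(2) by simp
  ultimately show ?thesis
    using fin assms(2) by (simp add: generators_def card_subset_eq)
qed

lemma (in comm_group) one_notin_minimal_zero_sum:
  assumes "minimal_zero_sum G S" "size S > 1"
  shows "\<one> \<notin># S"
proof
  assume "\<one> \<in># S"
  then have "{#\<one>#} \<subseteq># S" by simp
  moreover have "{#\<one>#} \<noteq> S"
    using assms(2) by auto
  ultimately have "{#\<one>#} \<subset># S"
    by (simp add: subset_mset.less_le)
  moreover have "zero_sum G {#\<one>#}"
    by (simp add: zero_sum_def seq_over_def seq_sum_add_mset seq_sum_empty)
  ultimately show False
    using assms(1) by (auto simp: minimal_zero_sum_def)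
qed

theorem proposition2p1:
  fixes G :: "('a, 'b) monoid_scheme" and p :: nat and S :: "'a multiset"
  assumes "group G" and "cyclic_group G"
    and "order G = p" and "prime p"
    and "minimal_zero_sum G S" and "size S = 5"
    and "max_mult G S \<ge> 3"
  shows "ind G S = 1"
proof -
  interpret comm_group G
    by (rule group.cyclic_imp_abelian_group[OF assms(1,2)])
  have fin: "finite (carrier G)"
    using prime_gt_0_nat[OF assms(4)] assms(3) order_gt_0_iff_finite by simp
  have zero: "zero_sum G S"
    using assms(5) by (simp add: minimal_zero_sum_def)
  have "max_mult G S \<in> (\<lambda>g. count S g) ` carrier G"
    unfolding max_mult_def using fin carrier_not_empty by (intro Max_in) auto
  then obtain g where g: "g \<in> carrier G" "count S g \<ge> 3"
    using assms(7) by auto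
  have "g \<in># S"
    using g(2) by (metis count_eq_zero_iff not_numeral_le_zero)
  then have "g \<noteq> \<one>\<^bsub>G\<^esub>"
    using one_notin_minimal_zero_sum[OF assms(5)] assms(6) by auto
  then have gen: "g \<in> generators G"
    using generator_if_prime_order assms(3,4) g(1) by blast
  have "replicate_mset 3 g \<subseteq># S"
    using g(2) by (simp add: count_le_replicate_mset_subset_eq)
  then obtain R where R: "S = replicate_mset 3 g + R"
    by (metis subset_mset.le_iff_add)
  then have "size R = Suc (Suc 0)"
    using assms(6) by simp
  then obtain x R' where R': "R = add_mset x R'"
    using size_eq_Suc_imp_eq_union by blast
  then have "size R' = 1"
    using \<open>size R = Suc (Suc 0)\<close> by simp
  then obtain y where "R' = {#y#}"
    using size_1_singleton_mset by blast
  then have "R = {#x, y#}"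
    using R' by simp
  then have norm: "seq_norm G g S = 1"
    using seq_norm_eq_1[OF fin gen assms(5)] R by blast
  have "finite (generators G)"
    using fin by (simp add: generators_def)
  moreover have "seq_norm G h S \<ge> 1" if "h \<in> generators G" for h
    using seq_norm_ge_1[OF fin that zero] \<open>g \<in># S\<close> by fastforce
  ultimately show ?thesis
    unfolding ind_def using gen norm by (intro Min_eqI) (auto simp: rev_image_eqI)
qed

end
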